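(* Let $\lambda\neq0$ be a real number. A smooth vector field on $(H_3,g_1)$ is affine if and only if it is Killing.
   Context: The Heisenberg group $H_3$ is $\mathbb{R}^3$ with global coordinates $(x,y,z)$ and multiplication $(x,y,z)(\tilde x,\tilde y,\tilde z)=(x+\tilde x,y+\tilde y,z+\tilde z-x\tilde y)$. For $\lambda\neq0$, $g_1$ is the left-invariant Lorentzian metric $g_1=-\frac{1}{\lambda^2}dx^2+dy^2+(x\,dy+dz)^2$. A smooth vector field $X$ on a pseudo-Riemannian manifold $(M,g)$ with Levi-Civita connection $\nabla$ is Killing if $\mathcal{L}_Xg=0$, and affine if $\mathcal{L}_X\nabla=0$, i.e. $[X,\nabla_YZ]=\nabla_{[X,Y]}Z+\nabla_Y[X,Z]$ for all vector fields $Y,Z$. *)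

theory Defs
  imports "HOL-Analysis.Analysis"
begin

section \<open>Smooth maps and vector fields\<close>

primrec times_cont_differentiable ::
    "nat \<Rightarrow> ('a::real_normed_vector \<Rightarrow> 'b::real_normed_vector) \<Rightarrow> bool" where
  "times_cont_differentiable 0 f \<longleftrightarrow> continuous_on UNIV f"
| "times_cont_differentiable (Suc k) f \<longleftrightarrow>
     (\<forall>p. f differentiable (at p)) \<and>
     (\<forall>v. times_cont_differentiable k (\<lambda>p. frechet_derivative f (at p) v))"

definition smooth :: "('a::real_normed_vector \<Rightarrow> 'b::real_normed_vector) \<Rightarrow> bool" where
  "smooth f \<longleftrightarrow> (\<forall>k. times_cont_differentiable k f)"

text \<open>
  The manifold is the vector space \<^typ>\<open>'a\<close> itself, covered by one global chart, with every
  tangent space identified with \<^typ>\<open>'a\<close>. Vector fields are maps \<^typ>\<open>'a \<Rightarrow> 'a\<close>, and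
  \<open>g p u v\<close> is the value of a metric at the point \<open>p\<close> on the tangent vectors \<open>u\<close>, \<open>v\<close>.
\<close>

type_synonym 'a vfield = "'a \<Rightarrow> 'a"
type_synonym 'a metric_tensor = "'a \<Rightarrow> 'a \<Rightarrow> 'a \<Rightarrow> real"
type_synonym 'a connection = "'a vfield \<Rightarrow> 'a vfield \<Rightarrow> 'a vfield"

definition dir_deriv ::
    "'a::real_normed_vector vfield \<Rightarrow> ('a \<Rightarrow> 'b::real_normed_vector) \<Rightarrow> 'a \<Rightarrow> 'b" where
  "dir_deriv X f p = frechet_derivative f (at p) (X p)"

text \<open>In coordinates \<open>[X, Y]\<^sup>i = X\<^sup>j \<partial>\<^sub>j Y\<^sup>i - Y\<^sup>j \<partial>\<^sub>j X\<^sup>i\<close>, so that \<open>[X, Y] f = X (Y f) - Y (X f)\<close>.\<close>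

definition lie_bracket :: "'a::real_normed_vector vfield \<Rightarrow> 'a vfield \<Rightarrow> 'a vfield" where
  "lie_bracket X Y p = dir_deriv X Y p - dir_deriv Y X p"

section \<open>Pseudo-Riemannian metrics, the Levi-Civita connection, Killing and affine fields\<close>

definition pseudo_riemannian_metric :: "'a::real_normed_vector metric_tensor \<Rightarrow> bool" where
  "pseudo_riemannian_metric g \<longleftrightarrow>
     (\<forall>p. bilinear (g p)) \<and>
     (\<forall>p u v. g p u v = g p v u) \<and>
     (\<forall>p u. (\<forall>v. g p u v = 0) \<longrightarrow> u = 0) \<and>
     (\<forall>u v. smooth (\<lambda>p. g p u v))"

text \<open>All conditions on a connection concern smooth fields only; its values on other maps are
  irrelevant.\<close>

definition affine_connection :: "'a::real_normed_vector connection \<Rightarrow> bool" where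
  "affine_connection nab \<longleftrightarrow>
     (\<forall>X Y. smooth X \<longrightarrow> smooth Y \<longrightarrow> smooth (nab X Y)) \<and>
     (\<forall>X Y Z. smooth X \<longrightarrow> smooth Y \<longrightarrow> smooth Z \<longrightarrow>
        nab (\<lambda>p. X p + Y p) Z = (\<lambda>p. nab X Z p + nab Y Z p)) \<and>
     (\<forall>(f::'a \<Rightarrow> real) X Z. smooth f \<longrightarrow> smooth X \<longrightarrow> smooth Z \<longrightarrow>
        nab (\<lambda>p. f p *\<^sub>R X p) Z = (\<lambda>p. f p *\<^sub>R nab X Z p)) \<and>
     (\<forall>X Y Z. smooth X \<longrightarrow> smooth Y \<longrightarrow> smooth Z \<longrightarrow>
        nab X (\<lambda>p. Y p + Z p) = (\<lambda>p. nab X Y p + nab X Z p)) \<and>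
     (\<forall>(f::'a \<Rightarrow> real) X Y. smooth f \<longrightarrow> smooth X \<longrightarrow> smooth Y \<longrightarrow>
        nab X (\<lambda>p. f p *\<^sub>R Y p) = (\<lambda>p. dir_deriv X f p *\<^sub>R Y p + f p *\<^sub>R nab X Y p))"

definition torsion_free :: "'a::real_normed_vector connection \<Rightarrow> bool" where
  "torsion_free nab \<longleftrightarrow>
     (\<forall>X Y. smooth X \<longrightarrow> smooth Y \<longrightarrow>
        (\<lambda>p. nab X Y p - nab Y X p) = lie_bracket X Y)"

definition metric_compatible ::
    "'a::real_normed_vector metric_tensor \<Rightarrow> 'a connection \<Rightarrow> bool" where
  "metric_compatible g nab \<longleftrightarrow>
     (\<forall>X Y Z. smooth X \<longrightarrow> smooth Y \<longrightarrow> smooth Z \<longrightarrow>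
        (\<forall>p. dir_deriv X (\<lambda>q. g q (Y q) (Z q)) p
             = g p (nab X Y p) (Z p) + g p (Y p) (nab X Z p)))"

definition levi_civita_connection ::
    "'a::real_normed_vector metric_tensor \<Rightarrow> 'a connection \<Rightarrow> bool" where
  "levi_civita_connection g nab \<longleftrightarrow>
     affine_connection nab \<and> torsion_free nab \<and> metric_compatible g nab"

definition lie_derivative_metric ::
    "'a::real_normed_vector vfield \<Rightarrow> 'a metric_tensor \<Rightarrow> 'a vfield \<Rightarrow> 'a vfield \<Rightarrow> 'a \<Rightarrow> real" where
  "lie_derivative_metric X g Y Z p =
     dir_deriv X (\<lambda>q. g q (Y q) (Z q)) p
     - g p (lie_bracket X Y p) (Z p) - g p (Y p) (lie_bracket X Z p)"

definition killing_field ::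
    "'a::real_normed_vector metric_tensor \<Rightarrow> 'a vfield \<Rightarrow> bool" where
  "killing_field g X \<longleftrightarrow> smooth X \<and>
     (\<forall>Y Z. smooth Y \<longrightarrow> smooth Z \<longrightarrow> (\<forall>p. lie_derivative_metric X g Y Z p = 0))"

definition affine_field ::
    "'a::real_normed_vector connection \<Rightarrow> 'a vfield \<Rightarrow> bool" where
  "affine_field nab X \<longleftrightarrow> smooth X \<and>
     (\<forall>Y Z. smooth Y \<longrightarrow> smooth Z \<longrightarrow>
        lie_bracket X (nab Y Z)
          = (\<lambda>p. nab (lie_bracket X Y) Z p + nab Y (lie_bracket X Z) p))"

section \<open>The Heisenberg group and its metric\<close>

definition heis_mult :: "real ^ 3 \<Rightarrow> real ^ 3 \<Rightarrow> real ^ 3" where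
  "heis_mult p q = vector [p $ 1 + q $ 1, p $ 2 + q $ 2, p $ 3 + q $ 3 - p $ 1 * q $ 2]"

text \<open>The coordinates \<open>(x, y, z)\<close> of \<open>p\<close> are \<open>p $ 1\<close>, \<open>p $ 2\<close>, \<open>p $ 3\<close>; likewise \<open>dx\<close>, \<open>dy\<close>, \<open>dz\<close>
  evaluate on a tangent vector to its components.\<close>

definition heis_metric :: "real \<Rightarrow> (real ^ 3) metric_tensor" where
  "heis_metric lam p u v =
     - (1 / lam\<^sup>2) * (u $ 1 * v $ 1) + u $ 2 * v $ 2
     + (p $ 1 * u $ 2 + u $ 3) * (p $ 1 * v $ 2 + v $ 3)"

definition left_invariant_metric :: "(real ^ 3) metric_tensor \<Rightarrow> bool" where
  "left_invariant_metric g \<longleftrightarrow>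
     (\<forall>a p u v. g (heis_mult a p)
        (frechet_derivative (heis_mult a) (at p) u)
        (frechet_derivative (heis_mult a) (at p) v) = g p u v)"

section \<open>Closure properties of smooth maps\<close>

lemma times_cont_differentiable_Suc_D:
  "times_cont_differentiable (Suc k) f \<Longrightarrow> times_cont_differentiable k f"
proof (induction k arbitrary: f)
  case 0
  then show ?case
    by (auto simp: continuous_on_eq_continuous_within intro: differentiable_imp_continuous_within)
next
  case (Suc k)
  then show ?case by simp
qed

lemma times_cont_differentiable_const: "times_cont_differentiable k (\<lambda>p. c)"
  by (induction k arbitrary: c) auto

lemma times_cont_differentiable_add:
  assumes "times_cont_differentiable k f" "times_cont_differentiable k g"
  shows "times_cont_differentiable k (\<lambda>p. f p + g p)"
  using assms
proof (induction k arbitrary: f g)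
  case 0
  then show ?case by (auto intro: continuous_on_add)
next
  case (Suc k)
  have d: "((\<lambda>p. f p + g p) has_derivative
      (\<lambda>v. frechet_derivative f (at p) v + frechet_derivative g (at p) v)) (at p)" for p
    using Suc.prems by (intro has_derivative_add) (auto simp: frechet_derivative_works[symmetric])
  have "frechet_derivative (\<lambda>p. f p + g p) (at p) v
      = frechet_derivative f (at p) v + frechet_derivative g (at p) v" for p v
    using frechet_derivative_at[OF d] by metis
  with Suc show ?case by simp
qed

lemma times_cont_differentiable_bilinear:
  assumes B: "bounded_bilinear B"
    and "times_cont_differentiable k f" "times_cont_differentiable k g"
  shows "times_cont_differentiable k (\<lambda>p. B (f p) (g p))"
  using assms(2-)
proof (induction k arbitrary: f g)
  case 0
  then show ?case using B by (auto intro: bounded_bilinear.continuous_on)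
next
  case (Suc k)
  have d: "((\<lambda>p. B (f p) (g p)) has_derivative
      (\<lambda>v. B (f p) (frechet_derivative g (at p) v) + B (frechet_derivative f (at p) v) (g p))) (at p)"
    for p
    using Suc.prems by (intro bounded_bilinear.FDERIV[OF B]) (auto simp: frechet_derivative_works[symmetric])
  have "frechet_derivative (\<lambda>p. B (f p) (g p)) (at p) v
      = B (f p) (frechet_derivative g (at p) v) + B (frechet_derivative f (at p) v) (g p)" for p v
    using frechet_derivative_at[OF d] by metis
  moreover have "times_cont_differentiable k f" "times_cont_differentiable k g"
    using Suc.prems times_cont_differentiable_Suc_D by blast+
  ultimately show ?case
    using Suc differentiableI[OF d] by (auto intro!: times_cont_differentiable_add)
qed

lemma smooth_imp_differentiable: "smooth f \<Longrightarrow> f differentiable (at p)"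
  unfolding smooth_def by (metis times_cont_differentiable.simps(2))

lemma smooth_frechet_derivative: "smooth f \<Longrightarrow> smooth (\<lambda>p. frechet_derivative f (at p) v)"
  unfolding smooth_def by (metis times_cont_differentiable.simps(2))

lemma smooth_const [simp]: "smooth (\<lambda>p. c)"
  by (simp add: smooth_def times_cont_differentiable_const)

lemma smooth_add [intro]: "smooth f \<Longrightarrow> smooth g \<Longrightarrow> smooth (\<lambda>p. f p + g p)"
  by (simp add: smooth_def times_cont_differentiable_add)

lemma smooth_bilinear:
  "bounded_bilinear B \<Longrightarrow> smooth f \<Longrightarrow> smooth g \<Longrightarrow> smooth (\<lambda>p. B (f p) (g p))"
  by (simp add: smooth_def times_cont_differentiable_bilinear)

lemma smooth_mult [intro]:
  fixes f g :: "_ \<Rightarrow> real" shows "smooth f \<Longrightarrow> smooth g \<Longrightarrow> smooth (\<lambda>p. f p * g p)"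
  by (rule smooth_bilinear[OF bounded_bilinear_mult])

lemma smooth_scaleR [intro]: "smooth f \<Longrightarrow> smooth g \<Longrightarrow> smooth (\<lambda>p. f p *\<^sub>R g p)"
  by (rule smooth_bilinear[OF bounded_bilinear_scaleR])

lemma smooth_inner [intro]: "smooth f \<Longrightarrow> smooth g \<Longrightarrow> smooth (\<lambda>p. f p \<bullet> g p)"
  by (rule smooth_bilinear[OF bounded_bilinear_inner])

lemma smooth_sum [intro]:
  "(\<And>i. i \<in> I \<Longrightarrow> smooth (f i)) \<Longrightarrow> smooth (\<lambda>p. \<Sum>i\<in>I. f i p)"
  by (induction I rule: infinite_finite_induct) auto

lemma smooth_id [simp]: "smooth (\<lambda>p::'a::real_normed_vector. p)"
proof -
  have "times_cont_differentiable k (\<lambda>p::'a. p)" for k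
    by (cases k) (auto simp: frechet_derivative_ident times_cont_differentiable_const)
  then show ?thesis by (simp add: smooth_def)
qed

lemma smooth_nth [intro]:
  fixes f :: "_ \<Rightarrow> real ^ 'n" shows "smooth f \<Longrightarrow> smooth (\<lambda>p. f p $ i)"
  by (simp add: cart_eq_inner_axis smooth_inner)

lemma smooth_dir_deriv [intro]:
  fixes X :: "'a::euclidean_space vfield"
  assumes "smooth X" "smooth f"
  shows "smooth (dir_deriv X f)"
proof -
  have "dir_deriv X f p = (\<Sum>b\<in>Basis. (X p \<bullet> b) *\<^sub>R frechet_derivative f (at p) b)" for p
  proof -
    have l: "linear (frechet_derivative f (at p))"
      using linear_frechet_derivative smooth_imp_differentiable[OF assms(2)] by blast
    have "dir_deriv X f p = frechet_derivative f (at p) (\<Sum>b\<in>Basis. (X p \<bullet> b) *\<^sub>R b)"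
      by (simp add: dir_deriv_def euclidean_representation)
    then show ?thesis by (simp add: linear_sum[OF l] linear_scale[OF l])
  qed
  then have "dir_deriv X f = (\<lambda>p. \<Sum>b\<in>Basis. (X p \<bullet> b) *\<^sub>R frechet_derivative f (at p) b)"
    by blast
  then show ?thesis
    using assms
    by (simp only:) (intro smooth_sum smooth_scaleR smooth_inner smooth_const
        smooth_frechet_derivative)
qed

lemma dir_deriv_bilinear:
  assumes "bounded_bilinear B" "smooth f" "smooth g"
  shows "dir_deriv X (\<lambda>p. B (f p) (g p)) p = B (f p) (dir_deriv X g p) + B (dir_deriv X f p) (g p)"
proof -
  have d: "((\<lambda>p. B (f p) (g p)) has_derivative
      (\<lambda>v. B (f p) (frechet_derivative g (at p) v) + B (frechet_derivative f (at p) v) (g p))) (at p)"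
    using assms
    by (intro bounded_bilinear.FDERIV)
      (auto simp: frechet_derivative_works[symmetric] smooth_imp_differentiable)
  show ?thesis unfolding dir_deriv_def using frechet_derivative_at[OF d] by metis
qed

lemma dir_deriv_add:
  assumes "smooth f" "smooth g"
  shows "dir_deriv X (\<lambda>p. f p + g p) p = dir_deriv X f p + dir_deriv X g p"
proof -
  have d: "((\<lambda>p. f p + g p) has_derivative
      (\<lambda>v. frechet_derivative f (at p) v + frechet_derivative g (at p) v)) (at p)"
    using assms by (intro has_derivative_add)
      (auto simp: frechet_derivative_works[symmetric] smooth_imp_differentiable)
  show ?thesis unfolding dir_deriv_def using frechet_derivative_at[OF d] by metis
qed

lemma dir_deriv_mult:
  fixes f g :: "_ \<Rightarrow> real"
  assumes "smooth f" "smooth g"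
  shows "dir_deriv X (\<lambda>p. f p * g p) p = f p * dir_deriv X g p + dir_deriv X f p * g p"
  using dir_deriv_bilinear[OF bounded_bilinear_mult assms] .

lemma dir_deriv_const: "dir_deriv X (\<lambda>p. c) p = 0"
  by (simp add: dir_deriv_def)

lemma dir_deriv_nth:
  fixes f :: "_ \<Rightarrow> real ^ 'n"
  assumes "smooth f"
  shows "dir_deriv X (\<lambda>p. f p $ i) p = dir_deriv X f p $ i"
  using dir_deriv_bilinear[OF bounded_bilinear_inner assms smooth_const[of "axis i 1"]]
  by (simp add: cart_eq_inner_axis dir_deriv_const)

lemma dir_deriv_id: "dir_deriv X (\<lambda>p. p) p = X p"
  by (simp add: dir_deriv_def frechet_derivative_ident)

section \<open>Basic facts about the Heisenberg metric\<close>

lemma heis_pseudo_riemannian: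
  assumes "lam \<noteq> 0" shows "pseudo_riemannian_metric (heis_metric lam)"
  unfolding pseudo_riemannian_metric_def
proof (intro conjI allI impI)
  fix p u v :: "real ^ 3"
  show "bilinear (heis_metric lam p)"
    unfolding bilinear_def heis_metric_def
      by (auto intro!: linearI simp: algebra_simps add_divide_distrib)
  show "heis_metric lam p u v = heis_metric lam p v u"
    by (simp add: heis_metric_def algebra_simps)
  show "smooth (\<lambda>p. heis_metric lam p u v)"
    unfolding heis_metric_def by (intro smooth_add smooth_mult smooth_const smooth_nth smooth_id)
next
  fix p u :: "real ^ 3"
  assume *: "\<forall>v. heis_metric lam p u v = 0"
  have "u $ 1 = 0"
    using *[rule_format, of "vector [1, 0, 0]"] assms by (simp add: heis_metric_def)
  moreover have "p $ 1 * u $ 2 + u $ 3 = 0"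
    using *[rule_format, of "vector [0, 0, 1]"] by (simp add: heis_metric_def)
  moreover from this have "u $ 2 = 0"
    using *[rule_format, of "vector [0, 1, 0]"] by (simp add: heis_metric_def)
  ultimately show "u = 0"
    by (simp add: vec_eq_iff forall_3)
qed

lemma heis_left_invariant: "left_invariant_metric (heis_metric lam)"
proof -
  have "frechet_derivative (heis_mult a) (at p) u
      = vector [u $ 1, u $ 2, u $ 3 - a $ 1 * u $ 2]" for a p u :: "real ^ 3"
  proof -
    let ?L = "\<lambda>u::real^3. (vector [u $ 1, u $ 2, u $ 3 - a $ 1 * u $ 2] :: real ^ 3)"
    have "linear ?L"
      by (auto intro!: linearI simp: vec_eq_iff forall_3 algebra_simps)
    then have "((\<lambda>p. a + ?L p) has_derivative ?L) (at p)"
      by (auto intro!: derivative_eq_intros simp: linear_imp_has_derivative)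
    moreover have "heis_mult a = (\<lambda>p. a + ?L p)"
      by (auto simp: heis_mult_def vec_eq_iff forall_3)
    ultimately show ?thesis
      by (metis (no_types, lifting) frechet_derivative_at)
  qed
  then show ?thesis
    by (simp add: left_invariant_metric_def heis_metric_def heis_mult_def algebra_simps)
qed

text \<open>The hypothesis of being a Levi-Civita connection of \<open>heis_metric lam\<close> is satisfiable; the
  witness is given by the Christoffel symbols of the metric.\<close>

lemma heis_levi_civita_exists:
  assumes "lam \<noteq> 0" shows "\<exists>nab. levi_civita_connection (heis_metric lam) nab"
proof -
  define b :: "real^3 \<Rightarrow> real^3 \<Rightarrow> nat \<Rightarrow> real" where
    "b u v n = (if n = 0 then u $ 2 * v $ 2
       else if n = 1 then u $ 2 * v $ 3 + u $ 3 * v $ 2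
       else if n = 2 then u $ 1 * v $ 2 + u $ 2 * v $ 1
       else u $ 1 * v $ 3 + u $ 3 * v $ 1)" for u v n
  define G :: "real^3 \<Rightarrow> real^3 \<Rightarrow> real^3 \<Rightarrow> real^3" where
    "G p u v = (lam * lam * (p $ 1 * b u v 0 + 1 / 2 * b u v 1)) *\<^sub>R axis 1 1
       + (1 / 2 * (p $ 1 * b u v 2 + b u v 3)) *\<^sub>R axis 2 1
       + (1 / 2 * ((1 + (- 1) * (p $ 1 * p $ 1)) * b u v 2 + (- 1) * (p $ 1 * b u v 3))) *\<^sub>R axis 3 1"
    for p u v
  have G_nth: "G p u v $ 1 = lam * lam * (p $ 1 * b u v 0 + 1 / 2 * b u v 1)"
    "G p u v $ 2 = 1 / 2 * (p $ 1 * b u v 2 + b u v 3)"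
    "G p u v $ 3 = 1 / 2 * ((1 + (- 1) * (p $ 1 * p $ 1)) * b u v 2 + (- 1) * (p $ 1 * b u v 3))"
    for p u v
    by (simp_all add: G_def axis_def)
  have G_sym: "G p u v = G p v u" for p u v
    by (simp add: G_def b_def algebra_simps)
  have G_add: "G p (u + u') v = G p u v + G p u' v" and G_scale: "G p (c *\<^sub>R u) v = c *\<^sub>R G p u v"
    for p u u' v c
    by (simp_all add: vec_eq_iff forall_3 G_nth b_def algebra_simps)
  have G_add': "G p v (u + u') = G p v u + G p v u'" and G_scale': "G p v (c *\<^sub>R u) = c *\<^sub>R G p v u"
    for p u u' v c
    by (simp_all add: G_sym[of p v] G_add G_scale)
  have lower: "heis_metric lam p (D + G p u v) w = heis_metric lam p D w
      - (p $ 1 * b u v 0 + b u v 1 / 2) * w $ 1 + (p $ 1 * b u v 2 + b u v 3 / 2) * w $ 2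
      + b u v 2 / 2 * w $ 3" for p D u v w
  proof -
    have "1 / lam\<^sup>2 * (lam * lam * c * d) = c * d" for c d
      using assms by (simp add: power2_eq_square)
    then have "1 / lam\<^sup>2 * ((D + G p u v) $ 1 * w $ 1)
        = 1 / lam\<^sup>2 * (D $ 1 * w $ 1) + (p $ 1 * b u v 0 + b u v 1 / 2) * w $ 1"
      by (simp add: G_nth distrib_right distrib_left)
    then show ?thesis
      by (simp add: heis_metric_def G_nth field_simps)
  qed
  have lower': "heis_metric lam p w (D + G p u v) = heis_metric lam p w D
      - (p $ 1 * b u v 0 + b u v 1 / 2) * w $ 1 + (p $ 1 * b u v 2 + b u v 3 / 2) * w $ 2
      + b u v 2 / 2 * w $ 3" for p D u v w
    using lower[of p D u v w] by (simp add: heis_metric_def mult.commute)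
  define nab :: "(real ^ 3) connection" where "nab X Y p = dir_deriv X Y p + G p (X p) (Y p)" for X Y p
  have lin: "linear (frechet_derivative Z (at p))" if "smooth Z" for Z :: "(real^3) vfield" and p
    using that linear_frechet_derivative smooth_imp_differentiable by blast
  have "affine_connection nab"
    unfolding affine_connection_def
  proof (intro conjI allI impI ext)
    fix X Y Z :: "(real^3) vfield" and p
    assume s: "smooth X" "smooth Y"
    show "smooth (nab X Y)"
      unfolding nab_def[abs_def] G_def b_def using s
      by (simp only: zero_neq_one refl if_True if_False one_neq_zero numeral_eq_iff num.distinct
          numeral_eq_one_iff one_eq_numeral_iff zero_neq_numeral numeral_neq_zero)
        (intro smooth_add smooth_scaleR smooth_mult smooth_const smooth_nth smooth_id
          smooth_dir_deriv)
    assume "smooth Z"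
    then show "nab (\<lambda>p. X p + Y p) Z p = nab X Z p + nab Y Z p"
      "nab X (\<lambda>p. Y p + Z p) p = nab X Y p + nab X Z p"
      using s by (simp_all add: nab_def G_add G_add' dir_deriv_add)
        (simp add: dir_deriv_def linear_add[OF lin])
  next
    fix f :: "real^3 \<Rightarrow> real" and X Z :: "(real^3) vfield" and p
    assume s: "smooth f" "smooth X" "smooth Z"
    show "nab (\<lambda>p. f p *\<^sub>R X p) Z p = f p *\<^sub>R nab X Z p"
      using s by (simp add: nab_def G_scale dir_deriv_def linear_scale[OF lin] algebra_simps)
    show "nab X (\<lambda>p. f p *\<^sub>R Z p) p = dir_deriv X f p *\<^sub>R Z p + f p *\<^sub>R nab X Z p"
      using s by (simp add: nab_def G_scale' dir_deriv_bilinear[OF bounded_bilinear_scaleR]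
          algebra_simps)
  qed
  moreover have "torsion_free nab"
    by (auto simp: torsion_free_def nab_def lie_bracket_def G_sym)
  moreover have "metric_compatible (heis_metric lam) nab"
    unfolding metric_compatible_def
  proof (intro allI impI)
    fix X Y Z :: "(real^3) vfield" and p
    assume s: "smooth X" "smooth Y" "smooth Z"
    have "dir_deriv X (\<lambda>q. heis_metric lam q (Y q) (Z q)) p =
      - (1 / lam\<^sup>2) * (Y p $ 1 * dir_deriv X Z p $ 1 + dir_deriv X Y p $ 1 * Z p $ 1)
      + (Y p $ 2 * dir_deriv X Z p $ 2 + dir_deriv X Y p $ 2 * Z p $ 2)
      + ((p $ 1 * Y p $ 2 + Y p $ 3) *
           (p $ 1 * dir_deriv X Z p $ 2 + X p $ 1 * Z p $ 2 + dir_deriv X Z p $ 3)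
         + (p $ 1 * dir_deriv X Y p $ 2 + X p $ 1 * Y p $ 2 + dir_deriv X Y p $ 3) *
           (p $ 1 * Z p $ 2 + Z p $ 3))"
      unfolding heis_metric_def
      by (simp only: dir_deriv_add dir_deriv_mult dir_deriv_const dir_deriv_nth dir_deriv_id
          smooth_add smooth_mult smooth_const smooth_nth smooth_id s)
    then show "dir_deriv X (\<lambda>q. heis_metric lam q (Y q) (Z q)) p
        = heis_metric lam p (nab X Y p) (Z p) + heis_metric lam p (Y p) (nab X Z p)"
      by (simp add: nab_def lower lower' b_def)
        (simp add: heis_metric_def field_simps flip: add_divide_distrib)
  qed
  ultimately show ?thesis unfolding levi_civita_connection_def by blast
qed

end

theory Submission
  imports Defs
begin

text \<open>
  For any metric \<open>g\<close>, the tensor \<open>A = L\<^sub>X \<nabla>\<close> is symmetric, and \<open>g (A Y Z) W + g Z (A Y W)\<close> is the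
  covariant derivative of \<open>L\<^sub>X g\<close>. If \<open>X\<close> is Killing, \<open>g (A Y Z) W\<close> is thus symmetric in the first
  two and skew in the last two arguments, so \<open>A = 0\<close>.

  Conversely, if \<open>X\<close> is affine then \<open>L\<^sub>X R = 0\<close>. In the orthonormal frame
  \<open>E\<^sub>1 = lam \<partial>\<^sub>x\<close>, \<open>E\<^sub>2 = \<partial>\<^sub>y - x \<partial>\<^sub>z\<close>, \<open>E\<^sub>3 = \<partial>\<^sub>z\<close> the curvature tensor has constant components, so this is
  a system of linear equations for the components \<open>b\<close> of \<open>[X, E\<^sub>i] = \<Sum> b\<^sub>i\<^sub>m E\<^sub>m\<close>. The sectional
  curvatures are nonzero and distinct enough that the system forces \<open>b\<close> to be skew with respect to \<open>g\<close>,
  which means \<open>L\<^sub>X g = 0\<close>.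
\<close>

section \<open>Symmetry of second derivatives and the Jacobi identity\<close>

lemma smooth_has_derivative:
  "smooth f \<Longrightarrow> (f has_derivative frechet_derivative f (at p)) (at p)"
  by (simp add: smooth_imp_differentiable flip: frechet_derivative_works)

lemma linear_frechet_derivative_smooth: "smooth f \<Longrightarrow> linear (frechet_derivative f (at p))"
  by (simp add: linear_frechet_derivative smooth_imp_differentiable)

lemma smooth_imp_continuous: "smooth f \<Longrightarrow> continuous (at p) f"
  by (simp add: differentiable_imp_continuous_within smooth_imp_differentiable)

lemma smooth_uminus [intro]: "smooth f \<Longrightarrow> smooth (\<lambda>p. - f p)"
  using smooth_scaleR[OF smooth_const[of "-1"], of f] by simp

lemma smooth_diff [intro]: "smooth f \<Longrightarrow> smooth g \<Longrightarrow> smooth (\<lambda>p. f p - g p)"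
  using smooth_add[OF _ smooth_uminus, of f g] by simp

lemma dir_deriv_diff:
  assumes "smooth f" "smooth g"
  shows "dir_deriv X (\<lambda>p. f p - g p) p = dir_deriv X f p - dir_deriv X g p"
proof -
  have "((\<lambda>p. f p - g p) has_derivative
      (\<lambda>v. frechet_derivative f (at p) v - frechet_derivative g (at p) v)) (at p)"
    using assms by (intro has_derivative_diff smooth_has_derivative)
  from frechet_derivative_at[OF this] show ?thesis
    unfolding dir_deriv_def by metis
qed

lemma smooth_lie_bracket [intro]:
  fixes X :: "'a::euclidean_space vfield"
  assumes "smooth X" "smooth Y" shows "smooth (lie_bracket X Y)"
  unfolding lie_bracket_def[abs_def] using assms by auto

text \<open>The chain rule along a line, which makes the one-variable mean value theorem available
  for functions on a normed space.\<close>

lemma DERIV_along_line: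
  fixes f :: "'a::real_normed_vector \<Rightarrow> real"
  assumes "smooth f"
  shows "((\<lambda>s. f (a + s *\<^sub>R u)) has_real_derivative frechet_derivative f (at (a + s *\<^sub>R u)) u) (at s)"
proof -
  have "((\<lambda>s. f (a + s *\<^sub>R u)) has_derivative
      (\<lambda>r. frechet_derivative f (at (a + s *\<^sub>R u)) (r *\<^sub>R u))) (at s)"
    by (rule has_derivative_compose[OF _ smooth_has_derivative[OF assms]])
      (auto intro!: derivative_eq_intros)
  then show ?thesis
    by (simp add: has_field_derivative_def linear_scale[OF linear_frechet_derivative_smooth[OF assms]]
        mult_commute_abs)
qed

text \<open>Two applications of the mean value theorem: first in direction \<open>u\<close> to the
  difference of \<open>f\<close> along two parallel lines, then in direction \<open>v\<close> to the
  derivative of \<open>f\<close> along \<open>u\<close>. The second difference on the left is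
  symmetric in \<open>u\<close> and \<open>v\<close>, while the right hand side is not.\<close>

lemma second_difference_mean_value:
  fixes f :: "'a::real_normed_vector \<Rightarrow> real"
  assumes f: "smooth f" and t: "t > 0"
  shows "\<exists>\<xi> \<eta>. 0 < \<xi> \<and> \<xi> < t \<and> 0 < \<eta> \<and> \<eta> < t \<and>
    f (p + t *\<^sub>R u + t *\<^sub>R v) - f (p + t *\<^sub>R u) - f (p + t *\<^sub>R v) + f p
      = t * t * frechet_derivative (\<lambda>q. frechet_derivative f (at q) u) (at (p + \<xi> *\<^sub>R u + \<eta> *\<^sub>R v)) v"
proof -
  let ?Du = "\<lambda>q. frechet_derivative f (at q) u"
  have "((\<lambda>s. f (p + t *\<^sub>R v + s *\<^sub>R u) - f (p + s *\<^sub>R u)) has_real_derivative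
      ?Du (p + t *\<^sub>R v + s *\<^sub>R u) - ?Du (p + s *\<^sub>R u)) (at s)" for s
    by (intro DERIV_diff DERIV_along_line f)
  from MVT2[OF t this] obtain \<xi> where \<xi>: "0 < \<xi>" "\<xi> < t"
    "f (p + t *\<^sub>R v + t *\<^sub>R u) - f (p + t *\<^sub>R u) - (f (p + t *\<^sub>R v + 0 *\<^sub>R u) - f (p + 0 *\<^sub>R u))
      = (t - 0) * (?Du (p + t *\<^sub>R v + \<xi> *\<^sub>R u) - ?Du (p + \<xi> *\<^sub>R u))"
    by metis
  have "((\<lambda>s. ?Du (p + \<xi> *\<^sub>R u + s *\<^sub>R v)) has_real_derivative
      frechet_derivative ?Du (at (p + \<xi> *\<^sub>R u + s *\<^sub>R v)) v) (at s)" for s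
    by (intro DERIV_along_line smooth_frechet_derivative f)
  from MVT2[OF t this] obtain \<eta> where \<eta>: "0 < \<eta>" "\<eta> < t"
    "?Du (p + \<xi> *\<^sub>R u + t *\<^sub>R v) - ?Du (p + \<xi> *\<^sub>R u + 0 *\<^sub>R v)
      = (t - 0) * frechet_derivative ?Du (at (p + \<xi> *\<^sub>R u + \<eta> *\<^sub>R v)) v"
    by metis
  have "f (p + t *\<^sub>R u + t *\<^sub>R v) - f (p + t *\<^sub>R u) - f (p + t *\<^sub>R v) + f p
      = t * (?Du (p + \<xi> *\<^sub>R u + t *\<^sub>R v) - ?Du (p + \<xi> *\<^sub>R u))"
    using \<xi>(3) by (simp add: ac_simps)
  also have "\<dots> = t * t * frechet_derivative ?Du (at (p + \<xi> *\<^sub>R u + \<eta> *\<^sub>R v)) v"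
    using \<eta>(3) by simp
  finally show ?thesis using \<xi> \<eta> by blast
qed

text \<open>Both mixed derivatives, at suitable points near \<open>p\<close>, equal the same second
  difference divided by \<open>t * t\<close>. Continuity carries this equality to
  \<open>p\<close>.\<close>

lemma second_derivative_symmetric_real:
  fixes f :: "'a::real_normed_vector \<Rightarrow> real"
  assumes f: "smooth f"
  shows "frechet_derivative (\<lambda>q. frechet_derivative f (at q) u) (at p) v
       = frechet_derivative (\<lambda>q. frechet_derivative f (at q) v) (at p) u" (is "?F p = ?G p")
proof (rule ccontr)
  assume ne: "?F p \<noteq> ?G p"
  \<comment> \<open>Half the gap: a common value at distance less than \<open>e\<close> from both
    \<open>?F p\<close> and \<open>?G p\<close> is impossible.\<close>
  define e where "e = \<bar>?F p - ?G p\<bar> / 2"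
  have e: "e > 0" using ne by (simp add: e_def)
  have cont: "continuous (at p) ?F" "continuous (at p) ?G"
    using f by (intro smooth_imp_continuous smooth_frechet_derivative; simp)+
  obtain d1 where d1: "d1 > 0" "\<And>q. dist q p < d1 \<Longrightarrow> dist (?F q) (?F p) < e"
    using cont(1) e unfolding continuous_at_eps_delta by blast
  obtain d2 where d2: "d2 > 0" "\<And>q. dist q p < d2 \<Longrightarrow> dist (?G q) (?G p) < e"
    using cont(2) e unfolding continuous_at_eps_delta by blast
  define d where "d = min d1 d2"
  \<comment> \<open>This size keeps all intermediate points within \<open>d\<close> of
    \<open>p\<close>; the summand 1 covers the case that \<open>u\<close> and \<open>v\<close> are
    both zero.\<close>
  define t where "t = d / (norm u + norm v + 1)"
  have pos: "norm u + norm v + 1 > 0" by (simp add: add_nonneg_pos)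
  have t: "t > 0" using d1 d2 pos by (simp add: t_def d_def)
  have close: "dist (p + a *\<^sub>R u + b *\<^sub>R v) p < d" if "0 < a" "a < t" "0 < b" "b < t" for a b
  proof -
    have "dist (p + a *\<^sub>R u + b *\<^sub>R v) p \<le> a * norm u + b * norm v"
      using norm_triangle_ineq[of "a *\<^sub>R u" "b *\<^sub>R v"] that by (simp add: dist_norm)
    also have "\<dots> \<le> t * norm u + t * norm v"
      using that by (intro add_mono mult_right_mono) auto
    also have "\<dots> < t * (norm u + norm v + 1)" using t by (simp add: algebra_simps)
    also have "\<dots> = d" using pos by (simp add: t_def)
    finally show ?thesis .
  qed
  obtain a b where ab: "0 < a" "a < t" "0 < b" "b < t"
    "f (p + t *\<^sub>R u + t *\<^sub>R v) - f (p + t *\<^sub>R u) - f (p + t *\<^sub>R v) + f p = t * t * ?F (p + a *\<^sub>R u + b *\<^sub>R v)"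
    using second_difference_mean_value[OF f t] by blast
  obtain a' b' where ab': "0 < a'" "a' < t" "0 < b'" "b' < t"
    "f (p + t *\<^sub>R v + t *\<^sub>R u) - f (p + t *\<^sub>R v) - f (p + t *\<^sub>R u) + f p = t * t * ?G (p + a' *\<^sub>R v + b' *\<^sub>R u)"
    using second_difference_mean_value[OF f t] by blast
  have "t * t * ?F (p + a *\<^sub>R u + b *\<^sub>R v) = t * t * ?G (p + a' *\<^sub>R v + b' *\<^sub>R u)"
    unfolding ab(5)[symmetric] ab'(5)[symmetric] by (simp add: ac_simps)
  then have "?F (p + a *\<^sub>R u + b *\<^sub>R v) = ?G (p + b' *\<^sub>R u + a' *\<^sub>R v)"
    using t by (simp add: ac_simps)
  moreover have "dist (?F (p + a *\<^sub>R u + b *\<^sub>R v)) (?F p) < e"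
    using close[OF ab(1-4)] by (intro d1) (simp add: d_def)
  moreover have "dist (?G (p + b' *\<^sub>R u + a' *\<^sub>R v)) (?G p) < e"
    using close[of b' a'] ab' by (intro d2) (simp add: d_def)
  ultimately show False
    using field_sum_of_halves[of "\<bar>?F p - ?G p\<bar>"] unfolding e_def dist_real_def by linarith
qed

lemma frechet_derivative_inner:
  assumes "smooth f"
  shows "frechet_derivative (\<lambda>q. f q \<bullet> c) (at p) v = frechet_derivative f (at p) v \<bullet> c"
proof -
  have "((\<lambda>q. f q \<bullet> c) has_derivative (\<lambda>v. frechet_derivative f (at p) v \<bullet> c)) (at p)"
    using has_derivative_inner_left smooth_has_derivative[OF assms] by blast
  from frechet_derivative_at[OF this] show ?thesis by metis
qed

lemma second_derivative_symmetric:
  fixes f :: "'a::real_normed_vector \<Rightarrow> 'b::euclidean_space"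
  assumes f: "smooth f"
  shows "frechet_derivative (\<lambda>q. frechet_derivative f (at q) u) (at p) v
       = frechet_derivative (\<lambda>q. frechet_derivative f (at q) v) (at p) u"
proof (rule euclidean_eqI)
  fix b :: 'b
  show "frechet_derivative (\<lambda>q. frechet_derivative f (at q) u) (at p) v \<bullet> b
      = frechet_derivative (\<lambda>q. frechet_derivative f (at q) v) (at p) u \<bullet> b"
    using second_derivative_symmetric_real[OF smooth_inner[OF f smooth_const[of b]], of u p v]
    by (simp add: frechet_derivative_inner f smooth_frechet_derivative)
qed

text \<open>Writing \<open>Y\<close> in the standard basis turns \<open>dir_deriv Y f\<close> into a
  sum of products, and the product rule splits off a second-order term and a first-order term. The
  basis sum keeps each inner derivative in a fixed direction, the form in which smoothness and
  symmetry of second derivatives are available.\<close>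

lemma dir_deriv_dir_deriv:
  fixes X Y :: "'a::euclidean_space vfield"
  assumes "smooth Y" "smooth f"
  shows "dir_deriv X (dir_deriv Y f) p
       = (\<Sum>b\<in>Basis. (Y p \<bullet> b) *\<^sub>R frechet_derivative (\<lambda>q. frechet_derivative f (at q) b) (at p) (X p))
       + frechet_derivative f (at p) (dir_deriv X Y p)"
proof -
  note lin = linear_frechet_derivative_smooth[OF assms(2)]
  have expand: "frechet_derivative f (at q) w = (\<Sum>b\<in>Basis. (w \<bullet> b) *\<^sub>R frechet_derivative f (at q) b)" for q w
    by (subst euclidean_representation[of w, symmetric])
      (simp only: linear_sum[OF lin] linear_scale[OF lin])
  have "((\<lambda>q. \<Sum>b\<in>Basis. (Y q \<bullet> b) *\<^sub>R frechet_derivative f (at q) b) has_derivative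
      (\<lambda>v. \<Sum>b\<in>Basis. (Y p \<bullet> b) *\<^sub>R frechet_derivative (\<lambda>q. frechet_derivative f (at q) b) (at p) v
        + (frechet_derivative Y (at p) v \<bullet> b) *\<^sub>R frechet_derivative f (at p) b)) (at p)"
    using assms
    by (intro has_derivative_sum has_derivative_scaleR smooth_has_derivative
        smooth_frechet_derivative has_derivative_inner_left) auto
  note D = fun_cong[OF frechet_derivative_at[OF this, symmetric], of "X p"]
  have "dir_deriv Y f = (\<lambda>q. \<Sum>b\<in>Basis. (Y q \<bullet> b) *\<^sub>R frechet_derivative f (at q) b)"
    by (rule ext, unfold dir_deriv_def, rule expand)
  with D have "dir_deriv X (dir_deriv Y f) p
     = (\<Sum>b\<in>Basis. (Y p \<bullet> b) *\<^sub>R frechet_derivative (\<lambda>q. frechet_derivative f (at q) b) (at p) (X p)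
        + (dir_deriv X Y p \<bullet> b) *\<^sub>R frechet_derivative f (at p) b)"
    by (simp only: dir_deriv_def[of X])
  then show ?thesis
    by (simp only: sum.distrib flip: expand)
qed

text \<open>The second-order terms of the two iterated derivatives agree by symmetry, and the
  first-order terms combine to the derivative along the bracket.\<close>

lemma dir_deriv_commutator:
  fixes X Y :: "'a::euclidean_space vfield" and f :: "'a \<Rightarrow> 'b::euclidean_space"
  assumes "smooth X" "smooth Y" "smooth f"
  shows "dir_deriv (lie_bracket X Y) f p = dir_deriv X (dir_deriv Y f) p - dir_deriv Y (dir_deriv X f) p"
proof -
  let ?H = "\<lambda>b. frechet_derivative (\<lambda>q. frechet_derivative f (at q) b) (at p)"
  have lin: "linear (?H b)" for b
    using assms(3) by (intro linear_frechet_derivative_smooth smooth_frechet_derivative)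
  \<comment> \<open>Linearity is known only in the outer direction, so symmetry first moves
    \<open>b\<close> there.\<close>
  have "(\<Sum>b\<in>Basis. (v \<bullet> b) *\<^sub>R ?H b u) = ?H u v" for u v
  proof -
    have "(\<Sum>b\<in>Basis. (v \<bullet> b) *\<^sub>R ?H b u) = (\<Sum>b\<in>Basis. (v \<bullet> b) *\<^sub>R ?H u b)"
      using second_derivative_symmetric[OF assms(3)] by metis
    also have "\<dots> = ?H u (\<Sum>b\<in>Basis. (v \<bullet> b) *\<^sub>R b)"
      by (simp only: linear_sum[OF lin] linear_scale[OF lin])
    finally show ?thesis by (simp add: euclidean_representation)
  qed
  then show ?thesis
    using second_derivative_symmetric[OF assms(3), of "X p" p "Y p"] assms
    by (simp add: dir_deriv_dir_deriv)
      (simp add: dir_deriv_def lie_bracket_def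
        linear_diff[OF linear_frechet_derivative_smooth[OF assms(3)]])
qed

text \<open>The commutator formula holds for vector-valued maps, so it applies to the fields
  themselves; expanded into iterated directional derivatives, both sides coincide.\<close>

lemma lie_bracket_jacobi:
  fixes X Y Z :: "'a::euclidean_space vfield"
  assumes "smooth X" "smooth Y" "smooth Z"
  shows "lie_bracket X (lie_bracket Y Z) p
       = lie_bracket (lie_bracket X Y) Z p + lie_bracket Y (lie_bracket X Z) p"
proof -
  have D: "dir_deriv U (lie_bracket V W) p = dir_deriv U (dir_deriv V W) p - dir_deriv U (dir_deriv W V) p"
    if "smooth V" "smooth W" for U V W :: "'a vfield"
    unfolding lie_bracket_def[abs_def] using that by (intro dir_deriv_diff) auto
  show ?thesis
    using assms
    by (simp add: lie_bracket_def[of X "lie_bracket Y Z"] lie_bracket_def[of "lie_bracket X Y" Z]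
        lie_bracket_def[of Y "lie_bracket X Z"] D dir_deriv_commutator)
qed

section \<open>Linearity and Leibniz rules for the bracket; expansion over sums of fields\<close>

lemma lie_bracket_add:
  assumes "smooth X" "smooth Y" "smooth Z"
  shows "lie_bracket X (\<lambda>p. Y p + Z p) = (\<lambda>p. lie_bracket X Y p + lie_bracket X Z p)"
  using assms
  by (intro ext, simp add: lie_bracket_def dir_deriv_add algebra_simps)
    (simp add: dir_deriv_def linear_add[OF linear_frechet_derivative_smooth])

lemma lie_bracket_diff:
  assumes "smooth X" "smooth Y" "smooth Z"
  shows "lie_bracket X (\<lambda>p. Y p - Z p) = (\<lambda>p. lie_bracket X Y p - lie_bracket X Z p)"
  using assms
  by (intro ext, simp add: lie_bracket_def dir_deriv_diff algebra_simps)
    (simp add: dir_deriv_def linear_diff[OF linear_frechet_derivative_smooth])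

lemma lie_bracket_scaleR:
  assumes "smooth X" "smooth Y" "smooth f"
  shows "lie_bracket X (\<lambda>p. f p *\<^sub>R Y p) = (\<lambda>p. dir_deriv X f p *\<^sub>R Y p + f p *\<^sub>R lie_bracket X Y p)"
  using assms
  by (intro ext, simp add: lie_bracket_def dir_deriv_bilinear[OF bounded_bilinear_scaleR] algebra_simps)
    (simp add: dir_deriv_def linear_scale[OF linear_frechet_derivative_smooth])

lemma lie_bracket_skew: "lie_bracket X Y = (\<lambda>p. - lie_bracket Y X p)"
  by (auto simp: lie_bracket_def)

text \<open>A common induction for expanding brackets, connections, curvature and Lie derivatives in
  a frame. Homogeneity is required only for the given \<open>c i\<close> and \<open>Y i\<close>, so
  that operators obeying a Leibniz rule are covered when the coefficients are constant.\<close>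

lemma additive_field_sum:
  fixes F :: "('a::real_normed_vector) vfield \<Rightarrow> 'a \<Rightarrow> 'b::real_vector"
  assumes add: "\<And>Y Z. smooth Y \<Longrightarrow> smooth Z \<Longrightarrow> F (\<lambda>p. Y p + Z p) = (\<lambda>p. F Y p + F Z p)"
    and scale: "\<And>i. i \<in> I \<Longrightarrow> F (\<lambda>p. c i p *\<^sub>R Y i p) = (\<lambda>p. c i p *\<^sub>R F (Y i) p)"
    and "finite I" "\<And>i. i \<in> I \<Longrightarrow> smooth (c i)" "\<And>i. i \<in> I \<Longrightarrow> smooth (Y i)"
  shows "F (\<lambda>p. \<Sum>i\<in>I. c i p *\<^sub>R Y i p) = (\<lambda>p. \<Sum>i\<in>I. c i p *\<^sub>R F (Y i) p)"
  using assms(3,2,4,5)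
proof (induction I rule: finite_induct)
  case empty
  have "F (\<lambda>p. 0) p = 0" for p
    using add[of "\<lambda>p. 0" "\<lambda>p. 0"] by (simp add: fun_eq_iff)
  then show ?case by auto
next
  case (insert i I)
  then show ?case by (simp add: add smooth_sum smooth_scaleR)
qed

section \<open>Lie derivatives of metrics, connections and curvature\<close>

lemma metric_bilinear: "pseudo_riemannian_metric g \<Longrightarrow> bilinear (g p)"
  by (simp add: pseudo_riemannian_metric_def)

lemma metric_sym: "pseudo_riemannian_metric g \<Longrightarrow> g p u v = g p v u"
  by (simp add: pseudo_riemannian_metric_def)

lemma metric_nondegenerate:
  "pseudo_riemannian_metric g \<Longrightarrow> (\<And>v. g p u v = 0) \<Longrightarrow> u = 0"
  unfolding pseudo_riemannian_metric_def by blast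

lemmas metric_linear =
  bilinear_ladd[OF metric_bilinear] bilinear_radd[OF metric_bilinear]
  bilinear_lsub[OF metric_bilinear] bilinear_rsub[OF metric_bilinear]
  bilinear_lmul[OF metric_bilinear] bilinear_rmul[OF metric_bilinear]

text \<open>The definition of a metric gives smoothness on constant vectors only; expanding both
  fields in the standard basis reduces to that case.\<close>

lemma smooth_metric:
  fixes g :: "'a::euclidean_space metric_tensor"
  assumes g: "pseudo_riemannian_metric g" and "smooth Y" "smooth Z"
  shows "smooth (\<lambda>p. g p (Y p) (Z p))"
proof -
  have eq: "g p (Y p) (Z p) = (\<Sum>(b, c)\<in>Basis \<times> Basis. (Z p \<bullet> c) * ((Y p \<bullet> b) * g p b c))" for p
    using bilinear_sum[OF metric_bilinear[OF g], of p "\<lambda>b. (Y p \<bullet> b) *\<^sub>R b" Basis "\<lambda>c. (Z p \<bullet> c) *\<^sub>R c" Basis]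
    by (simp add: euclidean_representation metric_linear[OF g])
  have "smooth (\<lambda>p. g p b c)" for b c
    using g by (simp add: pseudo_riemannian_metric_def)
  then show ?thesis
    unfolding eq using assms by (auto simp: case_prod_unfold intro!: smooth_sum smooth_mult)
qed

context
  fixes nab :: "'a::euclidean_space connection"
  assumes conn: "affine_connection nab"
begin

lemma smooth_connection: "smooth X \<Longrightarrow> smooth Y \<Longrightarrow> smooth (nab X Y)"
  using conn by (simp add: affine_connection_def)

lemma connection_add_left:
  "smooth X \<Longrightarrow> smooth Y \<Longrightarrow> smooth Z \<Longrightarrow> nab (\<lambda>p. X p + Y p) Z = (\<lambda>p. nab X Z p + nab Y Z p)"
  using conn by (simp add: affine_connection_def)

lemma connection_add_right:
  "smooth X \<Longrightarrow> smooth Y \<Longrightarrow> smooth Z \<Longrightarrow> nab X (\<lambda>p. Y p + Z p) = (\<lambda>p. nab X Y p + nab X Z p)"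
  using conn by (simp add: affine_connection_def)

lemma connection_scaleR_left:
  "smooth f \<Longrightarrow> smooth X \<Longrightarrow> smooth Z \<Longrightarrow> nab (\<lambda>p. f p *\<^sub>R X p) Z = (\<lambda>p. f p *\<^sub>R nab X Z p)"
  using conn by (simp add: affine_connection_def)

lemma connection_scaleR_right:
  "smooth f \<Longrightarrow> smooth X \<Longrightarrow> smooth Y \<Longrightarrow>
    nab X (\<lambda>p. f p *\<^sub>R Y p) = (\<lambda>p. dir_deriv X f p *\<^sub>R Y p + f p *\<^sub>R nab X Y p)"
  using conn by (simp add: affine_connection_def)

lemma connection_diff_left:
  assumes "smooth X" "smooth Y" "smooth Z"
  shows "nab (\<lambda>p. X p - Y p) Z = (\<lambda>p. nab X Z p - nab Y Z p)"
  using connection_add_left[of X "\<lambda>p. (-1) *\<^sub>R Y p" Z]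
    connection_scaleR_left[of "\<lambda>p. -1" Y Z] smooth_uminus[of Y] assms by simp

definition lie_derivative_connection :: "'a vfield \<Rightarrow> 'a vfield \<Rightarrow> 'a vfield \<Rightarrow> 'a vfield" where
  "lie_derivative_connection X Y Z p =
     lie_bracket X (nab Y Z) p - nab (lie_bracket X Y) Z p - nab Y (lie_bracket X Z) p"

definition curvature :: "'a vfield \<Rightarrow> 'a vfield \<Rightarrow> 'a vfield \<Rightarrow> 'a vfield" where
  "curvature Y Z W p = nab Y (nab Z W) p - nab Z (nab Y W) p - nab (lie_bracket Y Z) W p"

lemma affine_field_iff:
  "affine_field nab X \<longleftrightarrow> smooth X \<and>
     (\<forall>Y Z. smooth Y \<longrightarrow> smooth Z \<longrightarrow> (\<forall>p. lie_derivative_connection X Y Z p = 0))"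
  unfolding affine_field_def lie_derivative_connection_def fun_eq_iff
  by (simp add: algebra_simps)

text \<open>Torsion-freeness replaces each exchange of arguments by a bracket, and the remaining
  brackets cancel by the Jacobi identity.\<close>

lemma lie_derivative_connection_sym:
  assumes "torsion_free nab" "smooth X" "smooth Y" "smooth Z"
  shows "lie_derivative_connection X Y Z p = lie_derivative_connection X Z Y p"
proof -
  have T: "nab U V = (\<lambda>p. lie_bracket U V p + nab V U p)" if "smooth U" "smooth V" for U V
  proof -
    have "(\<lambda>p. nab U V p - nab V U p) = lie_bracket U V"
      using assms(1) that by (simp add: torsion_free_def)
    then show ?thesis by (auto simp: fun_eq_iff algebra_simps)
  qed
  have "lie_bracket X (nab Y Z) p = lie_bracket X (lie_bracket Y Z) p + lie_bracket X (nab Z Y) p"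
    using assms by (subst T) (simp_all add: lie_bracket_add smooth_lie_bracket smooth_connection)
  then show ?thesis
    using assms T[of "lie_bracket X Y" Z] T[of Y "lie_bracket X Z"] lie_bracket_jacobi[of X Y Z p]
    by (simp add: lie_derivative_connection_def smooth_lie_bracket)
qed

section \<open>Tensoriality of the curvature and its invariance under affine fields\<close>

lemma curvature_antisym:
  assumes "smooth Y" "smooth Z" "smooth W"
  shows "curvature Y Z W p = - curvature Z Y W p"
proof -
  have "nab (lie_bracket Y Z) W p = - nab (lie_bracket Z Y) W p"
    using connection_scaleR_left[of "\<lambda>p. -1" "lie_bracket Z Y" W] assms
    by (subst lie_bracket_skew) (simp add: smooth_lie_bracket)
  then show ?thesis by (simp add: curvature_def)
qed

lemma curvature_add1:
  assumes "smooth Y" "smooth Y'" "smooth Z" "smooth W"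
  shows "curvature (\<lambda>p. Y p + Y' p) Z W = (\<lambda>p. curvature Y Z W p + curvature Y' Z W p)"
proof -
  have "lie_bracket (\<lambda>p. Y p + Y' p) Z = (\<lambda>p. lie_bracket Y Z p + lie_bracket Y' Z p)"
    using lie_bracket_add[of Z Y Y'] assms by (subst (1 2 3) lie_bracket_skew) simp
  with assms show ?thesis
    by (intro ext, simp add: curvature_def connection_add_left connection_add_right
        smooth_connection smooth_lie_bracket)
qed

text \<open>The derivative of \<open>f\<close> along \<open>Z\<close> arises twice, from the Leibniz
  rule in \<open>nab Z (nab Y W)\<close> and from the bracket, and the two terms cancel.\<close>

lemma curvature_scaleR1:
  assumes "smooth f" "smooth Y" "smooth Z" "smooth W"
  shows "curvature (\<lambda>p. f p *\<^sub>R Y p) Z W = (\<lambda>p. f p *\<^sub>R curvature Y Z W p)"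
proof -
  have "lie_bracket (\<lambda>p. f p *\<^sub>R Y p) Z = (\<lambda>p. f p *\<^sub>R lie_bracket Y Z p - dir_deriv Z f p *\<^sub>R Y p)"
    using lie_bracket_scaleR[of Z Y f] assms by (subst (1 2) lie_bracket_skew) (simp add: fun_eq_iff)
  with assms show ?thesis
    by (intro ext, simp add: curvature_def connection_diff_left connection_scaleR_left
        connection_scaleR_right smooth_connection smooth_lie_bracket smooth_scaleR smooth_dir_deriv
        algebra_simps)
qed

lemma curvature_add2:
  assumes "smooth Y" "smooth Z" "smooth Z'" "smooth W"
  shows "curvature Y (\<lambda>p. Z p + Z' p) W = (\<lambda>p. curvature Y Z W p + curvature Y Z' W p)"
  using assms curvature_add1[of Z Z' Y W]
  by (simp add: fun_eq_iff curvature_antisym[of Y] smooth_add)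

lemma curvature_scaleR2:
  assumes "smooth f" "smooth Y" "smooth Z" "smooth W"
  shows "curvature Y (\<lambda>p. f p *\<^sub>R Z p) W = (\<lambda>p. f p *\<^sub>R curvature Y Z W p)"
  using assms curvature_scaleR1[of f Z Y W]
  by (simp add: fun_eq_iff curvature_antisym[of Y] smooth_scaleR)

lemma curvature_add3:
  assumes "smooth Y" "smooth Z" "smooth W" "smooth W'"
  shows "curvature Y Z (\<lambda>p. W p + W' p) = (\<lambda>p. curvature Y Z W p + curvature Y Z W' p)"
  using assms
  by (simp add: curvature_def fun_eq_iff connection_add_right smooth_connection smooth_lie_bracket)

text \<open>The second derivatives of \<open>f\<close> cancel against the derivative along
  \<open>lie_bracket Y Z\<close> by the commutator formula; the mixed first-order terms cancel in
  pairs.\<close>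

lemma curvature_scaleR3:
  assumes "smooth f" "smooth Y" "smooth Z" "smooth W"
  shows "curvature Y Z (\<lambda>p. f p *\<^sub>R W p) = (\<lambda>p. f p *\<^sub>R curvature Y Z W p)"
  using assms
  by (simp add: curvature_def fun_eq_iff connection_add_right connection_scaleR_right
      smooth_connection smooth_lie_bracket smooth_scaleR smooth_dir_deriv dir_deriv_commutator
      algebra_simps)

text \<open>This is the vanishing of the Lie derivative of the curvature: bracketing with
  \<open>X\<close> obeys a product rule over \<open>nab\<close> because \<open>X\<close> is affine,
  and over brackets by the Jacobi identity.\<close>

lemma lie_bracket_curvature:
  assumes X: "affine_field nab X" and s: "smooth Y" "smooth Z" "smooth W"
  shows "lie_bracket X (curvature Y Z W) p = curvature (lie_bracket X Y) Z W p
       + curvature Y (lie_bracket X Z) W p + curvature Y Z (lie_bracket X W) p"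
proof -
  have sX: "smooth X" using X by (simp add: affine_field_def)
  have L: "lie_bracket X (nab U V) = (\<lambda>p. nab (lie_bracket X U) V p + nab U (lie_bracket X V) p)"
    if "smooth U" "smooth V" for U V
    using X that by (simp add: affine_field_def)
  note S = smooth_connection smooth_lie_bracket smooth_add smooth_diff s sX
  have J: "lie_bracket X (lie_bracket Y Z)
      = (\<lambda>p. lie_bracket (lie_bracket X Y) Z p + lie_bracket Y (lie_bracket X Z) p)"
    using lie_bracket_jacobi[OF sX s(1,2)] by blast
  have "lie_bracket X (curvature Y Z W) p
      = lie_bracket X (nab Y (nab Z W)) p - lie_bracket X (nab Z (nab Y W)) p
        - lie_bracket X (nab (lie_bracket Y Z) W) p"
    unfolding curvature_def[abs_def] by (simp add: lie_bracket_diff S)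
  also have "\<dots> = curvature (lie_bracket X Y) Z W p
       + curvature Y (lie_bracket X Z) W p + curvature Y Z (lie_bracket X W) p"
    by (simp add: L S J connection_add_left connection_add_right curvature_def)
  finally show ?thesis .
qed

text \<open>The left hand side is the covariant derivative of the Lie derivative of the metric.\<close>

lemma lie_derivative_metric_derivative:
  assumes g: "pseudo_riemannian_metric g" and c: "metric_compatible g nab"
    and s: "smooth X" "smooth Y" "smooth Z" "smooth W"
  shows "dir_deriv Y (lie_derivative_metric X g Z W) p
       - lie_derivative_metric X g (nab Y Z) W p - lie_derivative_metric X g Z (nab Y W) p
     = g p (lie_derivative_connection X Y Z p) (W p) + g p (Z p) (lie_derivative_connection X Y W p)"
proof -
  let ?G = "\<lambda>U V q. g q (U q) (V q)"
  have C: "dir_deriv U (?G V V') = (\<lambda>q. ?G (nab U V) V' q + ?G V (nab U V') q)"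
    if "smooth U" "smooth V" "smooth V'" for U V V'
    using c that by (auto simp: metric_compatible_def)
  note S = smooth_connection smooth_lie_bracket smooth_metric[OF g] s
  have "dir_deriv Y (lie_derivative_metric X g Z W) p = dir_deriv Y (dir_deriv X (?G Z W)) p
     - dir_deriv Y (?G (lie_bracket X Z) W) p - dir_deriv Y (?G Z (lie_bracket X W)) p"
    unfolding lie_derivative_metric_def[abs_def]
    by (simp add: dir_deriv_diff S smooth_diff smooth_dir_deriv)
  \<comment> \<open>Exchanging the derivatives along \<open>X\<close> and \<open>Y\<close> costs a
    derivative along their bracket; metric compatibility then evaluates every derivative along
    \<open>Y\<close> or the bracket.\<close>
  moreover have "dir_deriv (lie_bracket X Y) (?G Z W) p
     = dir_deriv X (dir_deriv Y (?G Z W)) p - dir_deriv Y (dir_deriv X (?G Z W)) p"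
    by (intro dir_deriv_commutator S)
  moreover have "dir_deriv X (dir_deriv Y (?G Z W)) p
     = dir_deriv X (?G (nab Y Z) W) p + dir_deriv X (?G Z (nab Y W)) p"
    by (subst C[of Y]) (simp_all add: dir_deriv_add S)
  ultimately show ?thesis
    by (simp add: lie_derivative_metric_def lie_derivative_connection_def C[of Y]
        C[of "lie_bracket X Y"] S metric_linear[OF g])
qed

end

section \<open>Killing fields are affine\<close>

text \<open>Six alternating swaps lead back to the original order and include three sign changes, so
  \<open>T i j k\<close> equals its own negative. Indices range over a set \<open>S\<close> so that
  smooth fields can serve as indices as well as frame numbers.\<close>

lemma sym_skew_imp_zero:
  fixes T :: "'i \<Rightarrow> 'i \<Rightarrow> 'i \<Rightarrow> real"
  assumes sym: "\<And>i j k. i \<in> S \<Longrightarrow> j \<in> S \<Longrightarrow> k \<in> S \<Longrightarrow> T i j k = T j i k"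
    and skew: "\<And>i j k. i \<in> S \<Longrightarrow> j \<in> S \<Longrightarrow> k \<in> S \<Longrightarrow> T i j k = - T i k j"
    and "i \<in> S" "j \<in> S" "k \<in> S"
  shows "T i j k = 0"
proof -
  have "T i j k = T j i k" "T j i k = - T j k i" "T j k i = T k j i"
    "T k j i = - T k i j" "T k i j = T i k j" "T i k j = - T i j k"
    using assms by blast+
  then show ?thesis by linarith
qed

lemma killing_imp_affine:
  fixes nab :: "'a::euclidean_space connection"
  assumes g: "pseudo_riemannian_metric g" and nab: "levi_civita_connection g nab"
    and X: "killing_field g X"
  shows "affine_field nab X"
proof -
  have c: "affine_connection nab" "torsion_free nab" "metric_compatible g nab"
    using nab by (auto simp: levi_civita_connection_def)
  have sX: "smooth X" using X by (simp add: killing_field_def)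
  have h: "lie_derivative_metric X g Y Z = (\<lambda>p. 0)" if "smooth Y" "smooth Z" for Y Z
    using X that by (auto simp: killing_field_def)
  let ?A = "lie_derivative_connection nab X"
  have "g p (?A Y Z p) (W p) = 0" if "smooth Y" "smooth Z" "smooth W" for Y Z W p
  proof (rule sym_skew_imp_zero[where S = "{Y. smooth Y}" and T = "\<lambda>Y Z W. g p (?A Y Z p) (W p)"])
    fix Y Z W :: "'a vfield"
    assume s: "Y \<in> {Y. smooth Y}" "Z \<in> {Y. smooth Y}" "W \<in> {Y. smooth Y}"
    show "g p (?A Y Z p) (W p) = g p (?A Z Y p) (W p)"
      using s sX c by (simp add: lie_derivative_connection_sym)
    show "g p (?A Y Z p) (W p) = - g p (?A Y W p) (Z p)"
      using s lie_derivative_metric_derivative[OF c(1) g c(3) sX, of Y Z W p]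
      by (simp add: h smooth_connection[OF c(1)] dir_deriv_const metric_sym[OF g, of p "Z p"])
  qed (use that in auto)
  \<comment> \<open>Constant fields \<open>W\<close> already test against every tangent vector, so
    nondegeneracy applies.\<close>
  from this[of _ _ "\<lambda>p. v" for v] show ?thesis
    unfolding affine_field_iff[OF c(1)] using sX metric_nondegenerate[OF g] by (metis smooth_const)
qed

section \<open>Tensoriality of the Lie derivative of a metric\<close>

lemma lie_derivative_metric_sym:
  "pseudo_riemannian_metric g \<Longrightarrow> lie_derivative_metric X g Y Z = lie_derivative_metric X g Z Y"
  by (simp add: lie_derivative_metric_def fun_eq_iff metric_sym[of g _ "Z _"]
      metric_sym[of g _ _ "Y _"])

lemma lie_derivative_metric_add:
  fixes g :: "'a::euclidean_space metric_tensor"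
  assumes g: "pseudo_riemannian_metric g" and "smooth X" "smooth Y" "smooth Y'" "smooth Z"
  shows "lie_derivative_metric X g (\<lambda>p. Y p + Y' p) Z
       = (\<lambda>p. lie_derivative_metric X g Y Z p + lie_derivative_metric X g Y' Z p)"
  using assms
  by (simp add: lie_derivative_metric_def fun_eq_iff metric_linear[OF g] dir_deriv_add
      smooth_metric lie_bracket_add)

text \<open>The derivative of \<open>f\<close> from the product rule cancels the one from the
  bracket. This is what allows the Killing condition to be checked on a frame.\<close>

lemma lie_derivative_metric_scaleR:
  fixes g :: "'a::euclidean_space metric_tensor"
  assumes g: "pseudo_riemannian_metric g" and "smooth X" "smooth f" "smooth Y" "smooth Z"
  shows "lie_derivative_metric X g (\<lambda>p. f p *\<^sub>R Y p) Z = (\<lambda>p. f p *\<^sub>R lie_derivative_metric X g Y Z p)"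
  using assms
  by (simp add: lie_derivative_metric_def fun_eq_iff metric_linear[OF g] dir_deriv_mult
      smooth_metric lie_bracket_scaleR algebra_simps)

section \<open>An orthonormal frame on the Heisenberg group\<close>

definition heis_frame :: "real \<Rightarrow> 3 \<Rightarrow> (real ^ 3) vfield" where
  "heis_frame lam i p =
     (if i = 1 then lam *\<^sub>R axis 1 1 else if i = 2 then axis 2 1 - p $ 1 *\<^sub>R axis 3 1 else axis 3 1)"

text \<open>The dual basis of \<open>heis_frame\<close>: the forms dx/lam, dy and x dy + dz, in
  which the metric is diagonal.\<close>

definition heis_coframe :: "real \<Rightarrow> 3 \<Rightarrow> real ^ 3 \<Rightarrow> real ^ 3 \<Rightarrow> real" where
  "heis_coframe lam i p v =
     (if i = 1 then (1 / lam) * v $ 1 else if i = 2 then v $ 2 else p $ 1 * v $ 2 + v $ 3)"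

text \<open>The value of the metric on the pair of frame fields (E_i, E_i).\<close>

definition heis_sign :: "3 \<Rightarrow> real" where
  "heis_sign i = (if i = 1 then - 1 else 1)"

text \<open>Coefficient along E_k of the covariant derivative of E_j in direction E_i. The
  coefficients are constant; their antisymmetrisation in \<open>i\<close> and \<open>j\<close>
  encodes the only nontrivial bracket, [E_1, E_2] = - lam E_3.\<close>

definition heis_christoffel :: "real \<Rightarrow> 3 \<Rightarrow> 3 \<Rightarrow> 3 \<Rightarrow> real" where
  "heis_christoffel lam i j k =
     (if (i, j, k) \<in> {(1, 3, 2), (3, 1, 2), (2, 1, 3), (2, 3, 1), (3, 2, 1)} then lam / 2
      else if (i, j, k) = (1, 2, 3) then - lam / 2 else 0)"

definition heis_curvature :: "real \<Rightarrow> 3 \<Rightarrow> 3 \<Rightarrow> 3 \<Rightarrow> 3 \<Rightarrow> real" where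
  "heis_curvature lam i j k l =
     (\<Sum>m\<in>UNIV. heis_christoffel lam j k m * heis_christoffel lam i m l)
   - (\<Sum>m\<in>UNIV. heis_christoffel lam i k m * heis_christoffel lam j m l)
   - (\<Sum>m\<in>UNIV. (heis_christoffel lam i j m - heis_christoffel lam j i m) * heis_christoffel lam m k l)"

text \<open>The planes spanned by two frame fields have sectional curvature - lam^2 / 4 if they
  contain E_3, and 3 lam^2 / 4 for the plane of E_1 and E_2. All components not belonging to such a
  plane vanish.\<close>

lemma heis_curvature_eq:
  "heis_curvature lam i j k l =
     (if i = j then 0
      else if k = j \<and> l = i then (if i = 3 \<or> j = 3 then - 1 / 4 else 3 / 4) * heis_sign j * lam\<^sup>2
      else if k = i \<and> l = j then (if i = 3 \<or> j = 3 then 1 / 4 else - 3 / 4) * heis_sign i * lam\<^sup>2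
      else 0)"
  using exhaust_3[of i] exhaust_3[of j] exhaust_3[of k] exhaust_3[of l]
  by (elim disjE) (simp_all add: heis_curvature_def heis_christoffel_def heis_sign_def sum_3 power2_eq_square)

lemma smooth_heis_frame [simp]: "smooth (heis_frame lam i)"
proof -
  have "heis_frame lam i = (\<lambda>p. lam *\<^sub>R axis 1 1) \<or>
    heis_frame lam i = (\<lambda>p. axis 2 1 - p $ 1 *\<^sub>R axis 3 1) \<or> heis_frame lam i = (\<lambda>p. axis 3 1)"
    by (auto simp: heis_frame_def fun_eq_iff)
  moreover have "smooth (\<lambda>p::real^3. axis 2 1 - p $ 1 *\<^sub>R axis 3 1 :: real^3)"
    by (intro smooth_diff smooth_scaleR smooth_nth smooth_const smooth_id)
  ultimately show ?thesis by auto
qed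

lemma smooth_heis_coframe:
  assumes "smooth V" shows "smooth (\<lambda>p. heis_coframe lam i p (V p))"
proof -
  have "smooth (\<lambda>p. (1 / lam) * V p $ 1)" "smooth (\<lambda>p. V p $ 2)" "smooth (\<lambda>p. p $ 1 * V p $ 2 + V p $ 3)"
    using assms by (intro smooth_add smooth_mult smooth_nth smooth_const smooth_id; simp)+
  then show ?thesis
    by (cases "i = 1"; cases "i = 2") (simp_all add: heis_coframe_def)
qed

lemma linear_heis_coframe: "linear (heis_coframe lam i p)"
  by (rule linearI) (auto simp: heis_coframe_def algebra_simps add_divide_distrib)

lemma heis_coframe_frame:
  "lam \<noteq> 0 \<Longrightarrow> heis_coframe lam i p (heis_frame lam j p) = (if i = j then 1 else 0)"
  using exhaust_3[of i] exhaust_3[of j]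
  by (auto simp: heis_coframe_def heis_frame_def axis_def)

lemma heis_coframe_sum:
  "heis_coframe lam l p (\<Sum>i\<in>I. a i *\<^sub>R v i) = (\<Sum>i\<in>I. a i * heis_coframe lam l p (v i))"
  by (simp add: linear_sum[OF linear_heis_coframe] linear_scale[OF linear_heis_coframe])

lemma heis_frame_expand:
  "lam \<noteq> 0 \<Longrightarrow> v = (\<Sum>i\<in>UNIV. heis_coframe lam i p v *\<^sub>R heis_frame lam i p)"
  by (simp add: vec_eq_iff forall_3 sum_3 heis_coframe_def heis_frame_def axis_def)

lemma heis_metric_frame:
  "lam \<noteq> 0 \<Longrightarrow> heis_metric lam p v (heis_frame lam k p) = heis_sign k * heis_coframe lam k p v"
  using exhaust_3[of k]
  by (auto simp: heis_metric_def heis_coframe_def heis_frame_def heis_sign_def axis_def power2_eq_square)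

lemma dir_deriv_heis_frame:
  "dir_deriv V (heis_frame lam i) p = (if i = 2 then - (V p $ 1) *\<^sub>R axis 3 1 else 0)"
proof (cases "i = 2")
  case True
  then have "heis_frame lam i = (\<lambda>p. axis 2 1 - p $ 1 *\<^sub>R axis 3 1)"
    by (auto simp: heis_frame_def fun_eq_iff)
  then show ?thesis
    using True
    by (simp add: dir_deriv_diff dir_deriv_const smooth_scaleR smooth_nth
        dir_deriv_bilinear[OF bounded_bilinear_scaleR] dir_deriv_nth dir_deriv_id)
next
  case False
  then have "heis_frame lam i = (\<lambda>p. heis_frame lam i 0)"
    by (auto simp: heis_frame_def fun_eq_iff)
  then show ?thesis using False by (metis dir_deriv_const)
qed

lemma lie_bracket_heis_frame:
  "lie_bracket (heis_frame lam i) (heis_frame lam j) p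
     = (\<Sum>k\<in>UNIV. (heis_christoffel lam i j k - heis_christoffel lam j i k) *\<^sub>R heis_frame lam k p)"
  using exhaust_3[of i] exhaust_3[of j]
  by (auto simp: lie_bracket_def dir_deriv_heis_frame heis_christoffel_def sum_3 heis_frame_def axis_def
      vec_eq_iff)

section \<open>Connection and curvature in the frame; affine fields are Killing\<close>

context
  fixes lam :: real and nab :: "(real ^ 3) connection"
  assumes lam: "lam \<noteq> 0" and levi_civita: "levi_civita_connection (heis_metric lam) nab"
begin

lemma affine_conn: "affine_connection nab"
  and torsion: "torsion_free nab"
  and compatible: "metric_compatible (heis_metric lam) nab"
  using levi_civita by (auto simp: levi_civita_connection_def)

lemmas pseudo_riemannian = heis_pseudo_riemannian[OF lam]

text \<open>The uniqueness argument for the Levi-Civita connection: the difference between the true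
  and the claimed coefficients, with its last index lowered by \<open>heis_sign\<close>, is
  symmetric in the first two indices by torsion-freeness and skew in the last two by metric
  compatibility.\<close>

lemma connection_heis_frame:
  "nab (heis_frame lam i) (heis_frame lam j)
     = (\<lambda>p. \<Sum>k\<in>UNIV. heis_christoffel lam i j k *\<^sub>R heis_frame lam k p)"
proof
  fix p
  let ?E = "heis_frame lam" and ?\<Gamma> = "heis_christoffel lam" and ?g = "heis_metric lam"
  let ?G = "\<lambda>i j k. heis_coframe lam k p (nab (?E i) (?E j) p)"
  let ?T = "\<lambda>i j k. heis_sign k * (?G i j k - ?\<Gamma> i j k)"
  have "?T i j k = 0" for k
  proof (rule sym_skew_imp_zero[where S = UNIV and T = ?T])
    fix i j k :: 3
    have "nab (?E i) (?E j) p - nab (?E j) (?E i) p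
        = (\<Sum>k\<in>UNIV. (?\<Gamma> i j k - ?\<Gamma> j i k) *\<^sub>R ?E k p)"
      using torsion lie_bracket_heis_frame by (auto simp: torsion_free_def fun_eq_iff)
    then have "heis_coframe lam k p (nab (?E i) (?E j) p - nab (?E j) (?E i) p) = ?\<Gamma> i j k - ?\<Gamma> j i k"
      by (simp add: heis_coframe_sum heis_coframe_frame[OF lam]
        mult_delta_right)
    then show "?T i j k = ?T j i k"
      by (simp add: linear_diff[OF linear_heis_coframe])
    have "?g p (nab (?E i) (?E j) p) (?E k p) + ?g p (?E j p) (nab (?E i) (?E k) p)
        = dir_deriv (?E i) (\<lambda>q. ?g q (?E j q) (?E k q)) p"
      using compatible by (simp add: metric_compatible_def)
    \<comment> \<open>The metric has constant components in the frame.\<close>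
    also have "\<dots> = 0"
      by (simp add: heis_metric_frame[OF lam] heis_coframe_frame[OF lam] dir_deriv_const)
    finally have "heis_sign k * ?G i j k + heis_sign j * ?G i k j = 0"
      by (simp add: heis_metric_frame[OF lam] metric_sym[OF pseudo_riemannian, of _ "?E j p"])
    moreover have "heis_sign k * ?\<Gamma> i j k + heis_sign j * ?\<Gamma> i k j = 0"
      using exhaust_3[of i] exhaust_3[of j] exhaust_3[of k]
      by (elim disjE) (simp_all add: heis_christoffel_def heis_sign_def)
    ultimately show "?T i j k = - ?T i k j" by (simp add: algebra_simps)
  qed (rule UNIV_I)+
  moreover have "heis_sign k \<noteq> 0" for k
    by (simp add: heis_sign_def)
  ultimately have G: "?G i j k = ?\<Gamma> i j k" for k
    by (metis mult_eq_0_iff eq_iff_diff_eq_0)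
  show "nab (?E i) (?E j) p = (\<Sum>k\<in>UNIV. ?\<Gamma> i j k *\<^sub>R ?E k p)"
    by (subst heis_frame_expand[OF lam, of "nab (?E i) (?E j) p" p]) (simp only: G)
qed

text \<open>Since the connection coefficients are constant, no derivative terms arise, and the three
  terms of the curvature become the three sums in \<open>heis_curvature\<close>.\<close>

lemma curvature_heis_frame:
  "curvature nab (heis_frame lam i) (heis_frame lam j) (heis_frame lam k)
     = (\<lambda>p. \<Sum>l\<in>UNIV. heis_curvature lam i j k l *\<^sub>R heis_frame lam l p)"
proof
  fix p
  let ?E = "heis_frame lam" and ?\<Gamma> = "heis_christoffel lam"
  have right: "nab (?E i) (\<lambda>p. \<Sum>m\<in>UNIV. c m *\<^sub>R ?E m p) = (\<lambda>p. \<Sum>m\<in>UNIV. c m *\<^sub>R nab (?E i) (?E m) p)"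
    for i and c :: "3 \<Rightarrow> real"
    by (rule additive_field_sum[where c = "\<lambda>m p. c m"])
      (auto simp: connection_add_right[OF affine_conn] connection_scaleR_right[OF affine_conn]
        dir_deriv_const)
  have left: "nab (\<lambda>p. \<Sum>m\<in>UNIV. c m *\<^sub>R ?E m p) (?E i) = (\<lambda>p. \<Sum>m\<in>UNIV. c m *\<^sub>R nab (?E m) (?E i) p)"
    for i and c :: "3 \<Rightarrow> real"
    by (rule additive_field_sum[where c = "\<lambda>m p. c m" and F = "\<lambda>V. nab V (?E i)"])
      (auto simp: connection_add_left[OF affine_conn] connection_scaleR_left[OF affine_conn])
  have bracket: "lie_bracket (?E i) (?E j) = (\<lambda>p. \<Sum>m\<in>UNIV. (?\<Gamma> i j m - ?\<Gamma> j i m) *\<^sub>R ?E m p)"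
    using lie_bracket_heis_frame by blast
  have R: "heis_coframe lam l p (curvature nab (?E i) (?E j) (?E k) p) = heis_curvature lam i j k l" for l
    by (simp add: curvature_def[OF affine_conn] connection_heis_frame right bracket left heis_curvature_def
        linear_diff[OF linear_heis_coframe] heis_coframe_sum heis_coframe_frame[OF lam]
        mult_delta_right)
  show "curvature nab (?E i) (?E j) (?E k) p = (\<Sum>l\<in>UNIV. heis_curvature lam i j k l *\<^sub>R ?E l p)"
    by (subst heis_frame_expand[OF lam, of "curvature nab (?E i) (?E j) (?E k) p" p]) (simp only: R)
qed

text \<open>The vanishing of the Lie derivative of the curvature tensor. No derivative of a curvature
  component occurs, as these components are constant.\<close>

lemma affine_field_curvature_components:
  fixes X :: "(real ^ 3) vfield" and p :: "real ^ 3"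
  defines "b \<equiv> \<lambda>i m. heis_coframe lam m p (lie_bracket X (heis_frame lam i) p)"
  assumes X: "affine_field nab X"
  shows "(\<Sum>m\<in>UNIV. heis_curvature lam i j k m * b m l)
       = (\<Sum>m\<in>UNIV. b i m * heis_curvature lam m j k l) + (\<Sum>m\<in>UNIV. b j m * heis_curvature lam i m k l)
       + (\<Sum>m\<in>UNIV. b k m * heis_curvature lam i j m l)"
proof -
  let ?E = "heis_frame lam" and ?R = "curvature nab" and ?r = "heis_curvature lam"
  let ?b = "\<lambda>i m p. heis_coframe lam m p (lie_bracket X (?E i) p)"
  have sX: "smooth X" using X by (simp add: affine_field_def)
  have sb: "smooth (?b i m)" for i m
    by (intro smooth_heis_coframe smooth_lie_bracket sX smooth_heis_frame)
  have br: "lie_bracket X (?E i) = (\<lambda>p. \<Sum>m\<in>UNIV. ?b i m p *\<^sub>R ?E m p)" for i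
    using heis_frame_expand[OF lam] by blast
  have 0: "lie_bracket X (?R (?E i) (?E j) (?E k)) p = (\<Sum>m\<in>UNIV. ?r i j k m *\<^sub>R lie_bracket X (?E m) p)"
    unfolding curvature_heis_frame
    by (rule fun_cong[OF additive_field_sum[where c = "\<lambda>m p. ?r i j k m"]])
      (auto simp: lie_bracket_add lie_bracket_scaleR sX dir_deriv_const)
  \<comment> \<open>Here the coefficients vary from point to point, so tensoriality of the curvature
    in each slot is what brings them outside.\<close>
  have 1: "?R (lie_bracket X (?E i)) (?E j) (?E k) p = (\<Sum>m\<in>UNIV. b i m *\<^sub>R ?R (?E m) (?E j) (?E k) p)"
    unfolding b_def
    by (subst br, rule fun_cong[OF additive_field_sum[where F = "\<lambda>V. ?R V (?E j) (?E k)"]])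
      (auto simp: curvature_add1[OF affine_conn] curvature_scaleR1[OF affine_conn] sb)
  have 2: "?R (?E i) (lie_bracket X (?E j)) (?E k) p = (\<Sum>m\<in>UNIV. b j m *\<^sub>R ?R (?E i) (?E m) (?E k) p)"
    unfolding b_def
    by (subst br, rule fun_cong[OF additive_field_sum[where F = "\<lambda>V. ?R (?E i) V (?E k)"]])
      (auto simp: curvature_add2[OF affine_conn] curvature_scaleR2[OF affine_conn] sb)
  have 3: "?R (?E i) (?E j) (lie_bracket X (?E k)) p = (\<Sum>m\<in>UNIV. b k m *\<^sub>R ?R (?E i) (?E j) (?E m) p)"
    unfolding b_def
    by (subst br, rule fun_cong[OF additive_field_sum[where F = "\<lambda>V. ?R (?E i) (?E j) V"]])
      (auto simp: curvature_add3[OF affine_conn] curvature_scaleR3[OF affine_conn] sb)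
  have comp: "heis_coframe lam l p (?R (?E i) (?E j) (?E k) p) = ?r i j k l" for i j k
    by (simp add: curvature_heis_frame heis_coframe_sum heis_coframe_frame[OF lam]
        mult_delta_right)
  have "(\<Sum>m\<in>UNIV. ?r i j k m * b m l)
      = heis_coframe lam l p (lie_bracket X (?R (?E i) (?E j) (?E k)) p)"
    unfolding 0 heis_coframe_sum by (simp add: b_def)
  also have "\<dots> = (\<Sum>m\<in>UNIV. b i m * ?r m j k l) + (\<Sum>m\<in>UNIV. b j m * ?r i m k l)
       + (\<Sum>m\<in>UNIV. b k m * ?r i j m l)"
    unfolding lie_bracket_curvature[OF affine_conn X smooth_heis_frame smooth_heis_frame smooth_heis_frame]
      1 2 3 linear_add[OF linear_heis_coframe] heis_coframe_sum comp ..
  finally show ?thesis .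
qed

text \<open>Each choice of indices in the curvature equations isolates one entry of
  \<open>b\<close>, or one pair of entries. The result is the vanishing of the Lie derivative of the
  metric on frame fields.\<close>

lemma affine_field_skew:
  fixes X :: "(real ^ 3) vfield" and p :: "real ^ 3"
  defines "b \<equiv> \<lambda>i m. heis_coframe lam m p (lie_bracket X (heis_frame lam i) p)"
  assumes X: "affine_field nab X"
  shows "heis_sign j * b i j + heis_sign i * b j i = 0"
proof -
  have C: "(\<Sum>m\<in>UNIV. heis_curvature lam i j k m * b m l)
       = (\<Sum>m\<in>UNIV. b i m * heis_curvature lam m j k l) + (\<Sum>m\<in>UNIV. b j m * heis_curvature lam i m k l)
       + (\<Sum>m\<in>UNIV. b k m * heis_curvature lam i j m l)" for i j k l
    unfolding b_def by (rule affine_field_curvature_components[OF X])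
  note eval = sum_3 heis_curvature_eq heis_sign_def mult.commute
  \<comment> \<open>In the E_i component for R(E_i, E_j) E_j the terms with \<open>b i i\<close>
    cancel, leaving twice a nonzero curvature component times \<open>b j j\<close>.\<close>
  have "b 1 1 = 0" using C[of 2 1 1 2] lam by (simp add: eval)
  moreover have "b 2 2 = 0" using C[of 1 2 2 1] lam by (simp add: eval)
  moreover have "b 3 3 = 0" using C[of 1 3 3 1] lam by (simp add: eval)
  \<comment> \<open>For the entries mixing E_3 with another frame field, the factor is the
    difference of two curvature components, nonzero because 3/4 and - 1/4 differ.\<close>
  moreover have "b 2 3 = 0" using C[of 2 1 1 3] lam by (simp add: eval)
  moreover have "b 3 2 = 0" using C[of 3 1 1 2] lam by (simp add: eval)
  moreover have "b 1 3 = 0" using C[of 1 2 2 3] lam by (simp add: eval)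
  moreover have "b 3 1 = 0" using C[of 3 2 2 1] lam by (simp add: eval)
  \<comment> \<open>The two planes containing E_3 have equal curvature, so only a relation between
    these entries results; the sign of E_1 makes it precisely skewness for the metric, an
    infinitesimal boost.\<close>
  moreover have "b 1 2 = b 2 1" using C[of 3 1 2 3] lam by (simp add: eval)
  ultimately show ?thesis
    using exhaust_3[of i] exhaust_3[of j] by (auto simp: heis_sign_def)
qed

text \<open>On frame fields the metric is constant, so its Lie derivative is the negative of the
  expression in \<open>affine_field_skew\<close>. Tensoriality extends the vanishing to all smooth
  fields.\<close>

lemma affine_imp_killing:
  assumes X: "affine_field nab X"
  shows "killing_field (heis_metric lam) X"
proof -
  let ?E = "heis_frame lam" and ?g = "heis_metric lam"
  let ?h = "lie_derivative_metric X ?g"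
  have sX: "smooth X" using X by (simp add: affine_field_def)
  have frame: "?h (?E i) (?E j) = (\<lambda>p. 0)" for i j
  proof
    fix p
    have "dir_deriv X (\<lambda>q. ?g q (?E i q) (?E j q)) p = 0"
      by (simp add: heis_metric_frame[OF lam] heis_coframe_frame[OF lam] dir_deriv_const)
    then show "?h (?E i) (?E j) p = 0"
      using affine_field_skew[OF X, where i = i and j = j and p = p]
      by (simp add: lie_derivative_metric_def metric_sym[OF pseudo_riemannian, of p "?E i p"]
          heis_metric_frame[OF lam])
  qed
  have expand: "?h Y Z = (\<lambda>p. \<Sum>i\<in>UNIV. heis_coframe lam i p (Y p) *\<^sub>R ?h (?E i) Z p)"
    if "smooth Y" "smooth Z" for Y Z
  proof -
    have "Y = (\<lambda>p. \<Sum>i\<in>UNIV. heis_coframe lam i p (Y p) *\<^sub>R ?E i p)"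
      using heis_frame_expand[OF lam] by blast
    then have "?h Y Z = ?h (\<lambda>p. \<Sum>i\<in>UNIV. heis_coframe lam i p (Y p) *\<^sub>R ?E i p) Z"
      by (rule arg_cong[where f = "\<lambda>V. ?h V Z"])
    also have "\<dots> = (\<lambda>p. \<Sum>i\<in>UNIV. heis_coframe lam i p (Y p) *\<^sub>R ?h (?E i) Z p)"
      by (rule additive_field_sum[where F = "\<lambda>V. ?h V Z"])
        (auto simp: lie_derivative_metric_add[OF pseudo_riemannian] lie_derivative_metric_scaleR[OF pseudo_riemannian]
          smooth_heis_coframe sX that)
    finally show ?thesis .
  qed
  have "?h Y Z p = 0" if "smooth Y" "smooth Z" for Y Z p
  proof -
    \<comment> \<open>Symmetry moves \<open>Z\<close> to the first slot, where the frame expansion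
      applies; the expansion of \<open>Y\<close> follows.\<close>
    have "?h (?E i) Z = (\<lambda>p. 0)" for i
      using expand[of Z "?E i"] that frame
      by (simp add: lie_derivative_metric_sym[OF pseudo_riemannian, of X "?E i" Z])
    then show ?thesis using expand[OF that] by simp
  qed
  with sX show ?thesis by (simp add: killing_field_def)
qed

end

theorem theorem3p5:
  fixes lam :: real
    and nab :: "(real ^ 3) connection"
    and X :: "(real ^ 3) vfield"
  assumes "lam \<noteq> 0"
    and "levi_civita_connection (heis_metric lam) nab"
    and "smooth X"
  shows "affine_field nab X \<longleftrightarrow> killing_field (heis_metric lam) X"
  using affine_imp_killing[OF assms(1,2)]
    killing_imp_affine[OF heis_pseudo_riemannian[OF assms(1)] assms(2)] by blast

end
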